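(* Let $J\subset\mathbb{R}$ be an interval with $(0,1)\subset J$, let $h:J\to\mathbb{R}$ be a non-negative function with $h(\alpha)\ge\alpha$ for all $\alpha\in(0,1)$, and let $p,q>1$ with $\frac1p+\frac1q=1$. Let $I\subset[0,\infty)$ be an interval and let $f:I\to\mathbb{R}$ be differentiable on the interior $I^{\circ}$ of $I$. Let $a,b\in I^{\circ}$ with $a<b$, and suppose $h^{q}\in L[0,1]$ and $f'\in L[a,b]$. If $|f'|$ is $h$-convex on $I$, then $$\left|\frac{1}{b-a}\int_a^b f(x)\,dx-\frac13\left[\frac{f(a)+f(b)}{2}+2f\left(\frac{a+b}{2}\right)\right]\right|$$ $$\le\frac{b-a}{3}\left(\frac{1+2^{p+1}}{6(p+1)}\right)^{\frac1p}\left\{|f'(a)|\left[\left(\int_0^{\frac12}h^q(t)\,dt\right)^{\frac1q}+\left(\int_{\frac12}^1h^q(t)\,dt\right)^{\frac1q}\right]+|f'(b)|\left[\left(\int_0^{\frac12}h^q(1-t)\,dt\right)^{\frac1q}+\left(\int_{\frac12}^1h^q(1-t)\,dt\right)^{\frac1q}\right]\right\}.$$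
   Context: A function $g$ is $h$-convex on an interval if $g$ is non-negative and $g(tx+(1-t)y)\le h(t)g(x)+h(1-t)g(y)$ for all $x,y$ in the interval and all $t\in(0,1)$. Here "$|f'|$ is $h$-convex on $I$" refers to the points where $f'$ is defined, i.e. $I^{\circ}$. $h^q(t)$ means $(h(t))^q$. $L[c,d]$ denotes the Lebesgue integrable functions on $[c,d]$. *)

theory Defs
  imports "HOL-Analysis.Analysis"
begin

definition h_convex_on :: "(real \<Rightarrow> real) \<Rightarrow> real set \<Rightarrow> (real \<Rightarrow> real) \<Rightarrow> bool" where
  "h_convex_on h S g \<longleftrightarrow>
     (\<forall>x\<in>S. 0 \<le> g x) \<and>
     (\<forall>x\<in>S. \<forall>y\<in>S. \<forall>t\<in>{0<..<1}. g (t * x + (1 - t) * y) \<le> h t * g x + h (1 - t) * g y)"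

end

(* With F t = f (t a + (1 - t) b), integration by parts against the kernel t - s (s = 1/6 on [0, 1/2],
   s = 5/6 on [1/2, 1]) expresses the Simpson error as the integral of (t - s) F' t. The h-convexity of
   |f'| bounds |F' t| by (b - a) (h t |f' a| + h (1 - t) |f' b|), and Hoelder's inequality finishes,
   in fact with the factor (b - a) / 6 instead of (b - a) / 3. *)
theory Submission
  imports Defs
begin

section \<open>Hoelder's inequality, over a general measure space and on compact intervals\<close>

lemma Holder_inequality_integral:
  fixes u v :: "'a \<Rightarrow> real" and p q :: real
  assumes pq: "1 < p" "1 < q" "1 / p + 1 / q = 1"
    and meas: "u \<in> borel_measurable M" "v \<in> borel_measurable M"
    and nonneg: "\<And>x. x \<in> space M \<Longrightarrow> 0 \<le> u x" "\<And>x. x \<in> space M \<Longrightarrow> 0 \<le> v x"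
    and int: "integrable M (\<lambda>x. u x powr p)" "integrable M (\<lambda>x. v x powr q)"
  shows "integrable M (\<lambda>x. u x * v x)"
    and "(LINT x|M. u x * v x) \<le>
           (LINT x|M. u x powr p) powr (1 / p) * (LINT x|M. v x powr q) powr (1 / q)"
proof -
  let ?U = "LINT x|M. u x powr p" and ?V = "LINT x|M. v x powr q"
  \<comment> \<open>Young's inequality, applied pointwise without normalisation, supplies the
    integrable majorant that makes the product integrable.\<close>
  have young: "u x * v x \<le> u x powr p / p + v x powr q / q" if "x \<in> space M" for x
    using Youngs_inequality[OF pq] nonneg that by blast
  show int_uv: "integrable M (\<lambda>x. u x * v x)"
  proof (rule Bochner_Integration.integrable_bound)
    show "integrable M (\<lambda>x. u x powr p / p + v x powr q / q)"
      using int by simp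
    show "AE x in M. norm (u x * v x) \<le> norm (u x powr p / p + v x powr q / q)"
    proof (rule AE_I2)
      fix x assume "x \<in> space M"
      then show "norm (u x * v x) \<le> norm (u x powr p / p + v x powr q / q)"
        using young[of x] nonneg[of x] by (simp add: abs_mult)
    qed
  qed (use meas in measurable)
  have UV_nonneg: "0 \<le> ?U" "0 \<le> ?V" by simp_all
  show "(LINT x|M. u x * v x) \<le> ?U powr (1 / p) * ?V powr (1 / q)"
  \<comment> \<open>Normalising divides by both norms. If one of them vanishes, the corresponding
    factor is zero almost everywhere, hence so is the product.\<close>
  proof (cases "?U = 0 \<or> ?V = 0")
    case True
    have "AE x in M. u x * v x = 0"
      using True
    proof
      assume "?U = 0"
      then have "AE x in M. u x powr p = 0"
        using integral_nonneg_eq_0_iff_AE[OF int(1)] by simp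
      then show ?thesis by eventually_elim simp
    next
      assume "?V = 0"
      then have "AE x in M. v x powr q = 0"
        using integral_nonneg_eq_0_iff_AE[OF int(2)] by simp
      then show ?thesis by eventually_elim simp
    qed
    then have "(LINT x|M. u x * v x) = 0"
      by (rule integral_eq_zero_AE)
    then show ?thesis by simp
  next
    case False
    then have pos: "0 < ?U" "0 < ?V" using UV_nonneg by linarith+
    \<comment> \<open>These are the norms of \<open>u\<close> in L^p and \<open>v\<close> in L^q.
      Young's inequality for \<open>u / \<alpha>\<close> and \<open>v / \<beta>\<close> integrates
      to 1/p + 1/q = 1, so after multiplying back exactly \<open>\<alpha> * \<beta>\<close>
      remains.\<close>
    define \<alpha> \<beta> where "\<alpha> = ?U powr (1 / p)" and "\<beta> = ?V powr (1 / q)"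
    have ab: "0 < \<alpha>" "0 < \<beta>" using pos by (simp_all add: \<alpha>_def \<beta>_def)
    have ab_powr: "\<alpha> powr p = ?U" "\<beta> powr q = ?V"
      using pq pos by (simp_all add: \<alpha>_def \<beta>_def powr_powr)
    have bound: "u x * v x \<le> \<alpha> * \<beta> * (u x powr p / (p * ?U) + v x powr q / (q * ?V))"
      if "x \<in> space M" for x
    proof -
      have "u x / \<alpha> * (v x / \<beta>) \<le> (u x / \<alpha>) powr p / p + (v x / \<beta>) powr q / q"
        using nonneg[OF that] ab by (intro Youngs_inequality[OF pq]) simp_all
      also have "\<dots> = u x powr p / (p * ?U) + v x powr q / (q * ?V)"
        using nonneg[OF that] ab ab_powr by (simp add: powr_divide mult.commute)
      finally have "\<alpha> * \<beta> * (u x / \<alpha> * (v x / \<beta>)) \<le>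
          \<alpha> * \<beta> * (u x powr p / (p * ?U) + v x powr q / (q * ?V))"
        using ab by (intro mult_left_mono) simp_all
      then show ?thesis using ab by simp
    qed
    have "(LINT x|M. u x * v x) \<le>
        (LINT x|M. \<alpha> * \<beta> * (u x powr p / (p * ?U) + v x powr q / (q * ?V)))"
      using int int_uv bound by (intro integral_mono) auto
    also have "\<dots> = \<alpha> * \<beta> * (?U / (p * ?U) + ?V / (q * ?V))"
      using int by simp
    also have "\<dots> = \<alpha> * \<beta>"
      using pos pq by simp
    finally show ?thesis by (simp add: \<alpha>_def \<beta>_def)
  qed
qed

text \<open>The measure-theoretic version carries over to gauge integrals because a non-negative
  gauge integrable function is Lebesgue integrable, and powers under \<open>powr\<close> are
  non-negative.\<close>

lemma Holder_inequality_Icc: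
  fixes u v :: "real \<Rightarrow> real" and p q c d :: real
  assumes pq: "1 < p" "1 < q" "1 / p + 1 / q = 1"
    and nonneg: "\<And>x. x \<in> {c..d} \<Longrightarrow> 0 \<le> u x" "\<And>x. x \<in> {c..d} \<Longrightarrow> 0 \<le> v x"
    and int: "(\<lambda>x. u x powr p) integrable_on {c..d}" "(\<lambda>x. v x powr q) integrable_on {c..d}"
  shows "(\<lambda>x. u x * v x) integrable_on {c..d}"
    and "integral {c..d} (\<lambda>x. u x * v x) \<le>
           integral {c..d} (\<lambda>x. u x powr p) powr (1 / p) *
           integral {c..d} (\<lambda>x. v x powr q) powr (1 / q)"
proof -
  let ?M = "lebesgue_on {c..d}"
  have powr_int: "integrable ?M (\<lambda>x. w x powr r)"
    if "(\<lambda>x. w x powr r) integrable_on {c..d}" for w :: "real \<Rightarrow> real" and r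
    using nonnegative_absolutely_integrable_1[OF that]
    by (simp add: integrable_restrict_space set_integrable_def)
  \<comment> \<open>Only the power is known to be integrable; measurability of \<open>w\<close>
    itself is recovered by taking the r-th root, which is legitimate since \<open>w\<close> is
    non-negative on the interval.\<close>
  have meas: "w \<in> borel_measurable ?M"
    if "integrable ?M (\<lambda>x. w x powr r)" "1 < r" "\<And>x. x \<in> {c..d} \<Longrightarrow> 0 \<le> w x"
    for w :: "real \<Rightarrow> real" and r
  proof -
    have "(\<lambda>x. (w x powr r) powr (1 / r)) \<in> borel_measurable ?M"
      using that(1) by measurable
    moreover have "(w x powr r) powr (1 / r) = w x" if "x \<in> space ?M" for x
      using \<open>1 < r\<close> \<open>\<And>x. x \<in> {c..d} \<Longrightarrow> 0 \<le> w x\<close> that by (simp add: powr_powr)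
    ultimately show ?thesis
      using measurable_cong[of ?M "\<lambda>x. (w x powr r) powr (1 / r)" w borel] by blast
  qed
  note int' = powr_int[OF int(1)] powr_int[OF int(2)]
  note H = Holder_inequality_integral[OF pq meas[OF int'(1) pq(1) nonneg(1)]
      meas[OF int'(2) pq(2) nonneg(2)] _ _ int']
  have nn: "0 \<le> u x" "0 \<le> v x" if "x \<in> space ?M" for x
    using nonneg that by simp_all
  show "(\<lambda>x. u x * v x) integrable_on {c..d}"
    using H(1) nn by (intro integrable_on_lebesgue_on) auto
  show "integral {c..d} (\<lambda>x. u x * v x) \<le>
           integral {c..d} (\<lambda>x. u x powr p) powr (1 / p) *
           integral {c..d} (\<lambda>x. v x powr q) powr (1 / q)"
    using H nn int' by (simp add: lebesgue_integral_eq_integral)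
qed

section \<open>Two-point quadrature on an interval, with error kernel t - s\<close>

lemma has_integral_abs_diff_powr:
  fixes c s d p :: real
  assumes p: "-1 < p" and s: "c \<le> s" "s \<le> d"
  shows "((\<lambda>t. \<bar>t - s\<bar> powr p) has_integral
           ((s - c) powr (p + 1) + (d - s) powr (p + 1)) / (p + 1)) {c..d}"
proof -
  have R: "((\<lambda>t. \<bar>t\<bar> powr p) has_integral x powr (p + 1) / (p + 1)) {0..x}" if "0 \<le> x" for x
    using has_integral_powr_from_0[OF p that] by (rule has_integral_eq[rotated]) simp
  \<comment> \<open>With s moved to the origin, the piece to its left is the mirror image of a piece
    starting at 0.\<close>
  have "((\<lambda>t. \<bar>t\<bar> powr p) has_integral (s - c) powr (p + 1) / (p + 1)) {-(s - c)..0}"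
    using has_integral_reflect_lemma_real[OF R[of "s - c"]] s by simp
  then have "((\<lambda>t. \<bar>t\<bar> powr p) has_integral
      (s - c) powr (p + 1) / (p + 1) + (d - s) powr (p + 1) / (p + 1)) {c - s..d - s}"
    using R[of "d - s"] s by (intro has_integral_combine[where c = 0]) auto
  then show ?thesis
    using has_integral_shift_Icc_real[of "\<lambda>t. \<bar>t - s\<bar> powr p" s _ "c - s" "d - s"]
    by (simp add: o_def add_divide_distrib)
qed

text \<open>The node s of the kernel fixes the weights: \<open>d - s\<close> at d and
  \<open>s - c\<close> at c. The error is the integral of \<open>(t - s) * g t\<close>, and
  Hoelder's inequality is applied to |t - s| against \<open>u\<close> and \<open>v\<close>
  separately, so that A and B multiply separate norms.\<close>

lemma weighted_endpoint_rule_bound: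
  fixes F g u v :: "real \<Rightarrow> real" and p q c s d A B :: real
  assumes pq: "1 < p" "1 < q" "1 / p + 1 / q = 1"
    and s: "c \<le> s" "s \<le> d"
    and deriv: "\<And>t. t \<in> {c..d} \<Longrightarrow> (F has_real_derivative g t) (at t within {c..d})"
    and nonneg: "\<And>t. t \<in> {c..d} \<Longrightarrow> 0 \<le> u t" "\<And>t. t \<in> {c..d} \<Longrightarrow> 0 \<le> v t"
    and int: "(\<lambda>t. u t powr q) integrable_on {c..d}" "(\<lambda>t. v t powr q) integrable_on {c..d}"
    and AB: "0 \<le> A" "0 \<le> B"
    and bound: "\<And>t. t \<in> {c..d} \<Longrightarrow> \<bar>g t\<bar> \<le> A * u t + B * v t"
  shows "\<bar>(d - s) * F d + (s - c) * F c - integral {c..d} F\<bar> \<le>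
           (((s - c) powr (p + 1) + (d - s) powr (p + 1)) / (p + 1)) powr (1 / p) *
           (A * integral {c..d} (\<lambda>t. u t powr q) powr (1 / q) +
            B * integral {c..d} (\<lambda>t. v t powr q) powr (1 / q))"
proof -
  let ?k = "\<lambda>t. \<bar>t - s\<bar>"
  let ?K = "integral {c..d} (\<lambda>t. ?k t powr p) powr (1 / p)"
  have K: "((\<lambda>t. ?k t powr p) has_integral
      ((s - c) powr (p + 1) + (d - s) powr (p + 1)) / (p + 1)) {c..d}"
    using has_integral_abs_diff_powr pq s by simp
  note Hu = Holder_inequality_Icc[OF pq _ nonneg(1) has_integral_integrable[OF K] int(1), simplified]
  note Hv = Holder_inequality_Icc[OF pq _ nonneg(2) has_integral_integrable[OF K] int(2), simplified]
  \<comment> \<open>The integrand is the derivative of \<open>(t - s) * F t\<close>, so it is gauge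
    integrable. Subtracting the integral of the continuous \<open>F\<close> leaves the kernel term:
    this is the integration by parts.\<close>
  have "((\<lambda>t. F t + (t - s) * g t) has_integral (d - s) * F d - (c - s) * F c) {c..d}"
  proof (rule fundamental_theorem_of_calculus)
    show "((\<lambda>t. (t - s) * F t) has_vector_derivative F t + (t - s) * g t) (at t within {c..d})"
      if "t \<in> {c..d}" for t
      unfolding has_real_derivative_iff_has_vector_derivative[symmetric]
      by (auto intro!: derivative_eq_intros deriv[OF that])
  qed (use s in simp)
  moreover have "(F has_integral integral {c..d} F) {c..d}"
    using deriv by (intro integrable_integral integrable_continuous_real DERIV_continuous_on)
  ultimately have parts: "((\<lambda>t. (t - s) * g t) has_integral
      (d - s) * F d + (s - c) * F c - integral {c..d} F) {c..d}"
    by (auto dest: has_integral_diff simp: algebra_simps)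
  have "norm (integral {c..d} (\<lambda>t. (t - s) * g t)) \<le>
      integral {c..d} (\<lambda>t. A * (?k t * u t) + B * (?k t * v t))"
  proof (rule integral_norm_bound_integral)
    show "(\<lambda>t. (t - s) * g t) integrable_on {c..d}"
      using parts by blast
    show "(\<lambda>t. A * (?k t * u t) + B * (?k t * v t)) integrable_on {c..d}"
      using Hu(1) Hv(1) nonneg by (intro integrable_add integrable_on_mult_right) auto
    show "norm ((t - s) * g t) \<le> A * (?k t * u t) + B * (?k t * v t)" if "t \<in> {c..d}" for t
      using mult_left_mono[OF bound[of t], of "?k t"] that
      unfolding real_norm_def abs_mult by (simp add: distrib_left mult.left_commute)
  qed
  also have "\<dots> = A * integral {c..d} (\<lambda>t. ?k t * u t) + B * integral {c..d} (\<lambda>t. ?k t * v t)"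
    using Hu(1) Hv(1) nonneg by (subst integral_add) (auto intro: integrable_on_mult_right)
  also have "\<dots> \<le> A * (?K * integral {c..d} (\<lambda>t. u t powr q) powr (1 / q)) +
      B * (?K * integral {c..d} (\<lambda>t. v t powr q) powr (1 / q))"
    using Hu(2) Hv(2) nonneg AB by (intro add_mono mult_left_mono) auto
  finally show ?thesis
    using integral_unique[OF parts] integral_unique[OF K] by (simp add: algebra_simps)
qed

section \<open>Simpson's rule as two endpoint rules, one on each half of [0, 1]\<close>

theorem theorem3:
  fixes J I :: "real set" and h f :: "real \<Rightarrow> real" and p q a b :: real
  assumes J: "is_interval J" "{0<..<1} \<subseteq> J"
    and h_nonneg: "\<And>x. x \<in> J \<Longrightarrow> 0 \<le> h x"
    and h_ge: "\<And>\<alpha>. \<alpha> \<in> {0<..<1} \<Longrightarrow> \<alpha> \<le> h \<alpha>"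
    and pq: "1 < p" "1 < q" "1 / p + 1 / q = 1"
    and I: "is_interval I" "I \<subseteq> {0..}"
    and f_diff: "f differentiable_on interior I"
    and ab: "a \<in> interior I" "b \<in> interior I" "a < b"
    and h_int: "set_integrable lebesgue {0..1} (\<lambda>t. h t powr q)"
    and f'_int: "set_integrable lebesgue {a..b} (deriv f)"
    and f'_convex: "h_convex_on h (interior I) (\<lambda>x. \<bar>deriv f x\<bar>)"
  shows "\<bar>1 / (b - a) * (LINT x:{a..b}|lebesgue. f x)
            - 1 / 3 * ((f a + f b) / 2 + 2 * f ((a + b) / 2))\<bar>
    \<le> (b - a) / 3 * ((1 + 2 powr (p + 1)) / (6 * (p + 1))) powr (1 / p) *
       (\<bar>deriv f a\<bar> *
          ((LINT t:{0..1/2}|lebesgue. h t powr q) powr (1 / q)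
           + (LINT t:{1/2..1}|lebesgue. h t powr q) powr (1 / q))
        + \<bar>deriv f b\<bar> *
          ((LINT t:{0..1/2}|lebesgue. h (1 - t) powr q) powr (1 / q)
           + (LINT t:{1/2..1}|lebesgue. h (1 - t) powr q) powr (1 / q)))"
proof -
  text \<open>The values of \<open>h\<close> at the endpoints are unconstrained, so they are replaced by
    values for which the convexity inequality also holds at \<open>t = 0\<close> and \<open>t = 1\<close>.\<close>
  define k where "k t = (if t \<in> {0<..<1} then h t else t)" for t
  define A B where "A = \<bar>deriv f a\<bar>" and "B = \<bar>deriv f b\<bar>"
  \<comment> \<open>The segment is traversed from b at t = 0 to a at t = 1, so that in the convexity
    inequality \<open>h t\<close> multiplies |f' a| and \<open>h (1 - t)\<close> multiplies |f' b|.
    \<open>g\<close> is the derivative of \<open>F\<close>.\<close>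
  define F g where "F t = f (t * a + (1 - t) * b)"
    and "g t = (a - b) * deriv f (t * a + (1 - t) * b)" for t
  define C where "C = (((1 + 2 powr (p + 1)) / (6 * (p + 1))) powr (1 / p)) / 6"
  define N where "N c d w = integral {c..d} (\<lambda>t. w t powr q) powr (1 / q)"
    for c d and w :: "real \<Rightarrow> real"

  have k_nonneg: "0 \<le> k t" if "t \<in> {0..1}" for t
    using that J h_nonneg by (auto simp: k_def)
  have h_integrable: "(\<lambda>t. h t powr q) integrable_on {0..1}"
    using h_int set_lebesgue_integral_eq_integral(1) by blast
  then have k_integrable: "(\<lambda>t. k t powr q) integrable_on {0..1}"
    by (rule integrable_spike[where S = "{0, 1}"]) (auto simp: k_def)
  have reflect: "(\<lambda>t. w (1 - t)) integrable_on {0..1}" if "w integrable_on {0..1}"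
    for w :: "real \<Rightarrow> real"
    using integrable_on_affinity[of "-1" w 0 1 1] that by simp
  \<comment> \<open>This bridges the Lebesgue integrals of powers of \<open>h\<close> in the goal
    and the gauge integrals of powers of \<open>k\<close>: the functions may differ only at 0 and 1,
    a null set.\<close>
  have lint: "(LINT t:{c..d}|lebesgue. w t powr q) = integral {c..d} (\<lambda>t. w' t powr q)"
    if "(\<lambda>t. w t powr q) integrable_on {0..1}" "{c..d} \<subseteq> {0..1}"
      and "\<And>t. t \<in> {0<..<1} \<Longrightarrow> w t = w' t" for w w' :: "real \<Rightarrow> real" and c d
  proof -
    have "set_integrable lebesgue {c..d} (\<lambda>t. w t powr q)"
      using integrable_on_subinterval[OF that(1,2)]
      by (intro nonnegative_absolutely_integrable_1) auto
    then have "(LINT t:{c..d}|lebesgue. w t powr q) = integral {c..d} (\<lambda>t. w t powr q)"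
      by (rule set_lebesgue_integral_eq_integral)
    also have "\<dots> = integral {c..d} (\<lambda>t. w' t powr q)"
    proof (rule integral_spike[where S = "{0, 1}"])
      fix t assume "t \<in> {c..d} - {0, 1}"
      then have "t \<in> {0<..<1}" using that(2) by fastforce
      then show "w' t powr q = w t powr q" using that(3) by simp
    qed simp
    finally show ?thesis .
  qed

  have mem: "t * a + (1 - t) * b \<in> interior I" if "t \<in> {0..1}" for t
    using convexD[of "interior I" a b t "1 - t"] I(1) ab that
    by (simp add: convex_interior is_interval_convex)
  have f_deriv: "(f has_real_derivative deriv f x) (at x)" if "x \<in> interior I" for x
    using f_diff that differentiable_on_eq_differentiable_at[of "interior I" f]
    by (simp add: DERIV_deriv_iff_real_differentiable)
  have F_deriv: "(F has_real_derivative g t) (at t within S)" if "t \<in> {0..1}" for t S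
  proof -
    have "((\<lambda>t. t * a + (1 - t) * b) has_real_derivative a - b) (at t within S)"
      by (auto intro!: derivative_eq_intros)
    from DERIV_chain2[OF f_deriv[OF mem[OF that]] this] show ?thesis
      by (simp add: F_def[abs_def] g_def mult.commute)
  qed
  have g_bound: "\<bar>g t\<bar> \<le> (b - a) * A * k t + (b - a) * B * k (1 - t)" if "t \<in> {0..1}" for t
  proof -
    have "\<bar>deriv f (t * a + (1 - t) * b)\<bar> \<le> k t * A + k (1 - t) * B"
    proof (cases "t \<in> {0<..<1}")
      case True
      then show ?thesis
        using f'_convex ab by (simp add: h_convex_on_def k_def A_def B_def)
    next
      case False
      \<comment> \<open>Since k 0 = 0 and k 1 = 1, the bound is an equality here: it reads B at t =
        0 and A at t = 1.\<close>
      then have "t = 0 \<or> t = 1" using that by auto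
      then show ?thesis by (auto simp: k_def A_def B_def)
    qed
    from mult_left_mono[OF this, of "b - a"] ab show ?thesis
      by (simp add: g_def abs_mult distrib_left mult_ac)
  qed
  \<comment> \<open>The unordered pair covers both halves at once: s = 1/6 on [0, 1/2] and s = 5/6
    on [1/2, 1] give the same two distances in opposite order.\<close>
  have half: "\<bar>(d - s) * F d + (s - c) * F c - integral {c..d} F\<bar> \<le>
      C * (b - a) * (A * N c d k + B * N c d (\<lambda>t. k (1 - t)))"
    if "0 \<le> c" "d \<le> 1" "{s - c, d - s} = {1/6, 1/3}" for c d s
  proof -
    have sub: "{c..d} \<subseteq> {0..1}" using that by simp
    then have sub': "t \<in> {0..1}" if "t \<in> {c..d}" for t using that by blast
    have cd: "c \<le> s" "s \<le> d" using that(3) by (auto simp: doubleton_eq_iff)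
    have "\<bar>(d - s) * F d + (s - c) * F c - integral {c..d} F\<bar> \<le>
        (((s - c) powr (p + 1) + (d - s) powr (p + 1)) / (p + 1)) powr (1 / p) *
        ((b - a) * A * N c d k + (b - a) * B * N c d (\<lambda>t. k (1 - t)))"
      unfolding N_def
    proof (rule weighted_endpoint_rule_bound[OF pq cd])
      show "(\<lambda>t. k t powr q) integrable_on {c..d}"
        "(\<lambda>t. k (1 - t) powr q) integrable_on {c..d}"
        using integrable_on_subinterval[OF k_integrable sub]
          integrable_on_subinterval[OF reflect[OF k_integrable] sub] by simp_all
    qed (use sub' F_deriv g_bound k_nonneg ab in \<open>auto simp: A_def B_def\<close>)
    also have "(s - c) powr (p + 1) + (d - s) powr (p + 1) =
        (1/6) powr (p + 1) + (1/3) powr (p + 1)"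
      using that(3) unfolding doubleton_eq_iff
      by (elim disjE conjE) (simp_all only: add.commute)
    \<comment> \<open>Since 1/3 = 2 * (1/6), the power (1/6)^(p+1) factors out. One factor 1/6 stays
      in the bracket; the p-th root of (1/6)^p is the division by 6 in \<open>C\<close>.\<close>
    also have "(((1/6) powr (p + 1) + (1/3) powr (p + 1)) / (p + 1)) =
        (1/6) powr p * ((1 + 2 powr (p + 1)) / (6 * (p + 1)))"
    proof -
      have "(1/3::real) powr (p + 1) = (1/6) powr (p + 1) * 2 powr (p + 1)"
        by (simp add: powr_mult[symmetric])
      then show ?thesis using pq by (simp add: powr_add field_simps)
    qed
    also have "\<dots> powr (1 / p) = C"
      using pq by (subst powr_mult) (simp_all add: C_def powr_powr)
    finally show ?thesis by (simp add: algebra_simps)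
  qed

  have F_int: "F integrable_on {0..1}"
    using F_deriv by (intro integrable_continuous_real DERIV_continuous_on)
  have f_cont: "continuous_on {a..b} f"
  proof (rule DERIV_continuous_on)
    fix x assume x: "x \<in> {a..b}"
    have "x \<in> interior I"
      using x ab mem_is_interval_1_I[of "interior I" a b x] I(1)
      by (simp add: is_interval_convex_1 convex_interior)
    then show "(f has_real_derivative deriv f x) (at x within {a..b})"
      using f_deriv has_field_derivative_at_within by blast
  qed
  have "(LINT x:{a..b}|lebesgue. f x) = integral {a..b} f"
    using f_cont by (intro set_lebesgue_integral_eq_integral absolutely_integrable_continuous_real)
  also have "\<dots> = (b - a) * integral {0..1} F"
  proof -
    have "(f has_integral integral {a..b} f) (cbox a b)"
      using f_cont by (simp add: integrable_integral integrable_continuous_real)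
    \<comment> \<open>Substitution x = (a - b) t + b; the slope is negative, so its absolute value b
      - a appears, and the image set is the preimage of [a, b], namely [0, 1].\<close>
    from has_integral_affinity[OF this, of "a - b" b] ab
    have "((\<lambda>x. f ((a - b) * x + b)) has_integral integral {a..b} f / (b - a))
        ((\<lambda>x. (1 / (a - b)) * x - b / (a - b)) ` {a..b})" by simp
    moreover have "(\<lambda>x. (1 / (a - b)) * x - b / (a - b)) ` {a..b} = {0..1}"
      using ab by (subst image_affinity_atLeastAtMost_diff)
        (simp add: diff_divide_distrib[symmetric])
    moreover have "(\<lambda>x. f ((a - b) * x + b)) = F"
      by (simp add: F_def fun_eq_iff algebra_simps)
    ultimately show ?thesis using ab by (simp add: integral_unique)
  qed
  finally have "1 / (b - a) * (LINT x:{a..b}|lebesgue. f x) =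
      integral {0..1/2} F + integral {1/2..1} F"
    using ab F_int Henstock_Kurzweil_Integration.integral_combine[of 0 "1/2" 1 F] by simp
  moreover have "F 0 = f b" "F 1 = f a" "F (1/2) = f ((a + b) / 2)"
    by (simp_all add: F_def add_divide_distrib)
  \<comment> \<open>The endpoint weights are 1/6, 1/3 on the left half and 1/3, 1/6 on the right.
    Adding them at the shared midpoint gives Simpson's 1/6, 2/3, 1/6.\<close>
  ultimately have "1 / (b - a) * (LINT x:{a..b}|lebesgue. f x)
      - 1 / 3 * ((f a + f b) / 2 + 2 * f ((a + b) / 2)) =
      - (((1/2 - 1/6) * F (1/2) + (1/6 - 0) * F 0 - integral {0..1/2} F) +
         ((1 - 5/6) * F 1 + (5/6 - 1/2) * F (1/2) - integral {1/2..1} F))"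
    by (simp only:) (simp add: field_simps)
  then have "\<bar>1 / (b - a) * (LINT x:{a..b}|lebesgue. f x)
      - 1 / 3 * ((f a + f b) / 2 + 2 * f ((a + b) / 2))\<bar> \<le>
      \<bar>(1/2 - 1/6) * F (1/2) + (1/6 - 0) * F 0 - integral {0..1/2} F\<bar> +
      \<bar>(1 - 5/6) * F 1 + (5/6 - 1/2) * F (1/2) - integral {1/2..1} F\<bar>"
    by (simp only: abs_minus_cancel abs_triangle_ineq)
  also have "\<dots> \<le> C * (b - a) * (A * N 0 (1/2) k + B * N 0 (1/2) (\<lambda>t. k (1 - t))) +
      C * (b - a) * (A * N (1/2) 1 k + B * N (1/2) 1 (\<lambda>t. k (1 - t)))"
    by (intro add_mono half) (auto simp: doubleton_eq_iff)
  also have "\<dots> = C * ((b - a) * (A * (N 0 (1/2) k + N (1/2) 1 k) +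
      B * (N 0 (1/2) (\<lambda>t. k (1 - t)) + N (1/2) 1 (\<lambda>t. k (1 - t)))))"
    by (simp add: algebra_simps)
  \<comment> \<open>\<open>C\<close> carries the factor 1/6, while the goal has 1/3; as all factors
    are non-negative, \<open>C\<close> may be doubled.\<close>
  also have "\<dots> \<le> (2 * C) * ((b - a) * (A * (N 0 (1/2) k + N (1/2) 1 k) +
      B * (N 0 (1/2) (\<lambda>t. k (1 - t)) + N (1/2) 1 (\<lambda>t. k (1 - t)))))"
    using ab by (intro mult_right_mono mult_nonneg_nonneg add_nonneg_nonneg)
      (simp_all add: A_def B_def N_def C_def)
  finally show ?thesis
    using lint[OF h_integrable, of 0 "1/2" k] lint[OF h_integrable, of "1/2" 1 k]
      lint[OF reflect[OF h_integrable], of 0 "1/2" "\<lambda>t. k (1 - t)"]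
      lint[OF reflect[OF h_integrable], of "1/2" 1 "\<lambda>t. k (1 - t)"]
    by (simp add: k_def A_def B_def C_def N_def mult_ac)
qed

end
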